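(* Let $n$ be a positive integer and let $A, B \in M_n(\bar{\mathbb{R}})$. Then the following three conditions are equivalent: (i) $A \mathcal{R} B$; (ii) $C(A) = C(B)$ in affine tropical $n$-space; (iii) $PC(A) = PC(B)$ in projective tropical $(n-1)$-space. Similarly, the following three conditions are equivalent: (i') $A \mathcal{L} B$; (ii') $R(A) = R(B)$ in affine tropical $n$-space; (iii') $PR(A) = PR(B)$ in projective tropical $(n-1)$-space.
   Context: $\bar{\mathbb{R}} = \mathbb{R} \cup \{-\infty\}$ is the tropical semiring with $a \otimes b = a+b$ (with $-\infty$ absorbing) and $a \oplus b = \max\{a,b\}$. $M_n(\bar{\mathbb{R}})$ is the monoid of $n \times n$ matrices over $\bar{\mathbb{R}}$ under tropical matrix multiplication $(AB)_{ij} = \max_{1\le k\le n} (A_{ik} + B_{kj})$. In a monoid $S$: $A \mathcal{R} B$ means $AS = BS$, and $A \mathcal{L} B$ means $SA = SB$. Affine tropical $n$-space is $\bar{\mathbb{R}}^n$, with vector addition the componentwise maximum and scaling by $\lambda \in \bar{\mathbb{R}}$ adding $\lambda$ to every component. Projective tropical $(n-1)$-space is obtained from $\bar{\mathbb{R}}^n$ by discarding the zero vector $(-\infty,\ldots,-\infty)$ and identifying two non-zero vectors if one is a tropical multiple of the other. The column space $C(A)$ (respectively row space $R(A)$) is the set of all tropical linear combinations of the columns (respectively rows) of $A$. $PC(A)$ and $PR(A)$ are the projectivisations of $C(A)$ and $R(A)$, i.e. the sets of classes in projective tropical $(n-1)$-space of the non-zero vectors of $C(A)$ and $R(A)$. 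*)

theory Defs
  imports "HOL-Analysis.Analysis" "HOL-Algebra.Coset"
begin

text \<open>
  The tropical semiring on \<open>\<real> \<union> {-\<infinity>}\<close>. It is made an instance of the library's semiring classes,
  so on type \<open>trop\<close> the symbol \<open>+\<close> is the maximum, \<open>*\<close> is real addition, \<open>0\<close> is \<open>-\<infinity>\<close> and
  \<open>1\<close> is the real number zero. The operations \<open>**\<close>, \<open>*s\<close> and \<open>\<Sum>\<close>
  on \<open>trop\<close> vectors and matrices are thereby the tropical ones.
\<close>

typedef trop = "{x :: ereal. x \<noteq> \<infinity>}"
  by (rule exI[of _ 0]) simp

setup_lifting type_definition_trop

instantiation trop :: comm_semiring_1
begin

lift_definition zero_trop :: trop is "-\<infinity>" by simp
lift_definition one_trop :: trop is "0" by simp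
lift_definition plus_trop :: "trop \<Rightarrow> trop \<Rightarrow> trop" is max by (simp add: max_def)
lift_definition times_trop :: "trop \<Rightarrow> trop \<Rightarrow> trop" is "(+)" by simp

instance
proof
  fix a b c :: trop
  show "a + b + c = a + (b + c)" by transfer (rule max.assoc)
  show "a + b = b + a" by transfer (rule max.commute)
  show "0 + a = a" by transfer (simp add: max_def)
  show "a * b * c = a * (b * c)" by transfer (rule add.assoc)
  show "a * b = b * a" by transfer (rule add.commute)
  show "1 * a = a" by transfer simp
  show "0 * a = 0" by transfer simp
  show "a * 0 = 0" by transfer simp
  show "(0 :: trop) \<noteq> 1" by transfer simp
  show "(a + b) * c = a * c + b * c"
    by transfer (auto simp: max_def intro!: antisym add_right_mono)
qed

end

lemma trop_left_inverse:
  fixes a :: trop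
  assumes "a \<noteq> 0"
  shows "\<exists>b. b * a = 1"
  using assms
proof (transfer, goal_cases)
  case (1 a)
  then obtain r where "a = ereal r" by (cases a) auto
  then have "ereal (- r) + a = 0" "ereal (- r) \<noteq> \<infinity>" by simp_all
  then show ?case by blast
qed

definition trop_matrix_monoid :: "(trop ^ 'n ^ 'n) monoid" where
  "trop_matrix_monoid = \<lparr>carrier = UNIV, mult = (**), one = mat 1\<rparr>"

lemma monoid_trop_matrix_monoid: "monoid trop_matrix_monoid"
  by standard (simp_all add: trop_matrix_monoid_def matrix_mul_assoc)

definition green_R :: "('a, 'b) monoid_scheme \<Rightarrow> 'a \<Rightarrow> 'a \<Rightarrow> bool" where
  "green_R S a b \<longleftrightarrow> a <#\<^bsub>S\<^esub> carrier S = b <#\<^bsub>S\<^esub> carrier S"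

definition green_L :: "('a, 'b) monoid_scheme \<Rightarrow> 'a \<Rightarrow> 'a \<Rightarrow> bool" where
  "green_L S a b \<longleftrightarrow> carrier S #>\<^bsub>S\<^esub> a = carrier S #>\<^bsub>S\<^esub> b"

definition col_space :: "trop ^ 'n ^ 'm \<Rightarrow> (trop ^ 'm) set" where
  "col_space A = {\<Sum>j\<in>UNIV. c j *s column j A | c :: 'n \<Rightarrow> trop. True}"

definition row_space :: "trop ^ 'n ^ 'm \<Rightarrow> (trop ^ 'n) set" where
  "row_space A = {\<Sum>i\<in>UNIV. c i *s row i A | c :: 'm \<Rightarrow> trop. True}"

definition proj_rel :: "((trop ^ 'n) \<times> (trop ^ 'n)) set" where
  "proj_rel = {(x, y). x \<noteq> 0 \<and> y \<noteq> 0 \<and> ((\<exists>k. y = k *s x) \<or> (\<exists>k. x = k *s y))}"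

lemma equiv_proj_rel: "equiv (UNIV - {0}) (proj_rel :: ((trop ^ 'n) \<times> (trop ^ 'n)) set)"
proof -
  have sym: "\<exists>l. x = l *s y" if "y \<noteq> 0" "y = k *s x" for x y :: "trop ^ 'n" and k
  proof -
    have "k \<noteq> 0" using that by auto
    then obtain l where "l * k = 1" using trop_left_inverse by blast
    then have "x = l *s y" using that by (simp add: vector_smult_assoc)
    then show ?thesis by blast
  qed
  have iff: "(x, y) \<in> proj_rel \<longleftrightarrow> x \<noteq> 0 \<and> y \<noteq> 0 \<and> (\<exists>k. y = k *s x)" for x y :: "trop ^ 'n"
  proof -
    have "\<exists>k. y = k *s x" if "x \<noteq> 0" "\<exists>k. x = k *s y"
      using that(2) by (elim exE) (rule sym[OF that(1)])
    then show ?thesis unfolding proj_rel_def mem_Collect_eq case_prod_conv by argo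
  qed
  show ?thesis
  proof (rule equivI)
    show "proj_rel \<subseteq> (UNIV - {0 :: trop ^ 'n}) \<times> (UNIV - {0})"
      by (simp add: proj_rel_def subset_iff)
    show "refl_on (UNIV - {0 :: trop ^ 'n}) proj_rel"
    proof (rule refl_onI)
      fix x :: "trop ^ 'n"
      assume "x \<in> UNIV - {0}"
      moreover have "x = 1 *s x" by simp
      ultimately show "(x, x) \<in> proj_rel" unfolding iff by blast
    qed
    show "sym (proj_rel :: ((trop ^ 'n) \<times> (trop ^ 'n)) set)"
      by (rule symI) (simp add: proj_rel_def disj_commute)
    show "trans (proj_rel :: ((trop ^ 'n) \<times> (trop ^ 'n)) set)"
    proof (rule transI)
      fix x y z :: "trop ^ 'n"
      assume "(x, y) \<in> proj_rel" "(y, z) \<in> proj_rel"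
      then obtain k l where "x \<noteq> 0" "z \<noteq> 0" "y = k *s x" "z = l *s y"
        unfolding iff by (elim conjE exE)
      moreover from this have "z = (l * k) *s x" by simp
      ultimately show "(x, z) \<in> proj_rel" unfolding iff by (intro conjI exI[of _ "l * k"])
    qed
  qed
qed

text \<open>
  Projective space itself is \<open>(UNIV - {0}) // proj_rel\<close>. Since \<open>//\<close> collects the images
  \<open>proj_rel `` {x}\<close>, the elements of \<open>projectivise X\<close> are full classes of projective space,
  not their traces on \<open>X\<close>.
\<close>

definition projectivise :: "(trop ^ 'n) set \<Rightarrow> (trop ^ 'n) set set" where
  "projectivise X = (X - {0}) // proj_rel"

definition proj_col_space :: "trop ^ 'n ^ 'm \<Rightarrow> (trop ^ 'm) set set" where
  "proj_col_space A = projectivise (col_space A)"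

definition proj_row_space :: "trop ^ 'n ^ 'm \<Rightarrow> (trop ^ 'n) set set" where
  "proj_row_space A = projectivise (row_space A)"

end

theory Submission
  imports Defs
begin

text \<open>
  A column of \<open>A ** X\<close> is \<open>A\<close> applied to a column of \<open>X\<close>, and \<open>X\<close> is arbitrary, so the right
  ideal generated by \<open>A\<close> consists of the matrices whose columns all lie in the column space of \<open>A\<close>
  (lemma \<open>range_matrix_mult_eq\<close>). Conversely the ideal determines the column space: \<open>x\<close> lies in the
  column space exactly if the matrix with all columns equal to \<open>x\<close> lies in the ideal. Hence two
  matrices are \<open>\<R>\<close>-related if and only if their column spaces agree.

  Passing to projective space loses nothing, because a column space contains the zero vector and is
  closed under scaling. Nonzero tropical scalars are invertible, so such a set is the union of
  \<open>{0}\<close> and the projective classes that it meets (lemma \<open>projectivise_inject\<close>).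

  Transposition reverses products and exchanges rows with columns, which turns the statement on
  \<open>\<R>\<close> into the one on \<open>\<L>\<close>.
\<close>

lemma col_space_eq_range: "col_space A = range ((*v) A)"
proof -
  have combination: "(\<Sum>j\<in>UNIV. c j *s column j A) = A *v (\<chi> j. c j)" for c
    by (simp add: vec_eq_iff matrix_vector_mult_def column_def mult.commute)
  show ?thesis
  proof (intro equalityI subsetI)
    fix x assume "x \<in> range ((*v) A)"
    then obtain v where "x = A *v v" by blast
    then have "x = (\<Sum>j\<in>UNIV. v $ j *s column j A)"
      by (simp add: combination)
    then show "x \<in> col_space A" unfolding col_space_def by blast
  qed (auto simp: col_space_def combination)
qed

lemma row_space_eq_col_space_transpose: "row_space A = col_space (transpose A)"
  by (simp add: row_space_def col_space_def)

lemma column_matrix_mult: "column j (A ** X) = A *v column j X"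
  for A :: "'a::semiring_1 ^ 'n ^ 'm"
  by (simp add: vec_eq_iff column_def matrix_matrix_mult_def matrix_vector_mult_def)

text \<open>
  The columns of \<open>X\<close> can be chosen independently of each other, so solving \<open>A ** X = M\<close> means
  solving one linear system for each column of \<open>M\<close>.
\<close>

lemma range_matrix_mult_eq:
  fixes A :: "trop ^ 'n ^ 'm"
  shows "range (\<lambda>X :: trop ^ 'p ^ 'n. A ** X) = {M. \<forall>j. column j M \<in> col_space A}"
proof (intro equalityI subsetI)
  fix M :: "trop ^ 'p ^ 'm"
  assume "M \<in> {M. \<forall>j. column j M \<in> col_space A}"
  then have "\<forall>j. \<exists>v. column j M = A *v v"
    by (auto simp: col_space_eq_range)
  then obtain v where v: "\<And>j. column j M = A *v v j" by metis
  define X :: "trop ^ 'p ^ 'n" where "X = (\<chi> i j. v j $ i)"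
  have "column j X = v j" for j
    by (simp add: X_def column_def)
  then have "column j M = column j (A ** X)" for j
    by (simp add: v column_matrix_mult)
  then have "M = A ** X"
    by (simp add: column_def vec_eq_iff)
  then show "M \<in> range (\<lambda>X. A ** X)" by blast
qed (auto simp: column_matrix_mult col_space_eq_range)

lemma green_R_iff_range:
  fixes A B :: "trop ^ 'n ^ 'n"
  shows "green_R trop_matrix_monoid A B \<longleftrightarrow> range (\<lambda>X :: trop ^ 'n ^ 'n. A ** X) = range (\<lambda>X. B ** X)"
  by (simp add: green_R_def trop_matrix_monoid_def l_coset_def UNION_singleton_eq_range)

lemma green_L_iff_range:
  fixes A B :: "trop ^ 'n ^ 'n"
  shows "green_L trop_matrix_monoid A B \<longleftrightarrow> range (\<lambda>X :: trop ^ 'n ^ 'n. X ** A) = range (\<lambda>X. X ** B)"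
  by (simp add: green_L_def trop_matrix_monoid_def r_coset_def UNION_singleton_eq_range)

theorem green_R_iff_col_space:
  fixes A B :: "trop ^ 'n ^ 'n"
  shows "green_R trop_matrix_monoid A B \<longleftrightarrow> col_space A = col_space B"
proof
  assume "green_R trop_matrix_monoid A B"
  then have ideals: "{M :: trop ^ 'n ^ 'n. \<forall>j. column j M \<in> col_space A} =
      {M. \<forall>j. column j M \<in> col_space B}"
    by (simp add: green_R_iff_range range_matrix_mult_eq)
  show "col_space A = col_space B"
  proof (rule Set.set_eqI)
    fix x
    \<comment> \<open>The matrix with all columns \<open>x\<close> turns membership in the ideal into membership of \<open>x\<close>.\<close>
    define M :: "trop ^ 'n ^ 'n" where "M = (\<chi> i j. x $ i)"
    have "column j M = x" for j
      by (simp add: M_def column_def)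
    then have "x \<in> col_space C \<longleftrightarrow> M \<in> {M. \<forall>j. column j M \<in> col_space C}"
      for C :: "trop ^ 'n ^ 'n"
      by simp
    then show "x \<in> col_space A \<longleftrightarrow> x \<in> col_space B"
      using ideals by blast
  qed
qed (simp add: green_R_iff_range range_matrix_mult_eq)

lemma green_L_iff_green_R_transpose:
  "green_L trop_matrix_monoid A B \<longleftrightarrow> green_R trop_matrix_monoid (transpose A) (transpose B)"
proof -
  have ideal: "range (\<lambda>X :: trop ^ 'a ^ 'a. transpose C ** X) =
      transpose ` range (\<lambda>X :: trop ^ 'a ^ 'a. X ** C)"
    for C :: "trop ^ 'a ^ 'a"
  proof -
    have surj: "range (transpose :: trop ^ 'a ^ 'a \<Rightarrow> _) = UNIV"
      by (rule surjI) (rule transpose_transpose)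
    have "range (\<lambda>X :: trop ^ 'a ^ 'a. transpose C ** X) =
        (\<lambda>X. transpose C ** X) ` range transpose"
      by (simp only: surj)
    then show ?thesis
      by (simp add: image_image matrix_transpose_mul)
  qed
  have "inj (transpose :: trop ^ 'a ^ 'a \<Rightarrow> _)"
    by (rule inj_on_inverseI) (rule transpose_transpose)
  then show ?thesis
    unfolding green_L_iff_range green_R_iff_range ideal by (simp add: inj_image_eq_iff)
qed

theorem green_L_iff_row_space:
  "green_L trop_matrix_monoid A B \<longleftrightarrow> row_space A = row_space B"
  by (simp add: green_L_iff_green_R_transpose green_R_iff_col_space
      row_space_eq_col_space_transpose)

text \<open>
  A class that meets a set closed under scaling lies inside it, since two nonzero vectors of the
  same class are multiples of each other.
\<close>

lemma class_in_projectivise_iff: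
  assumes scale: "\<And>k x. x \<in> X \<Longrightarrow> k *s x \<in> X" and "x \<noteq> 0"
  shows "proj_rel `` {x} \<in> projectivise X \<longleftrightarrow> x \<in> X"
proof
  assume "proj_rel `` {x} \<in> projectivise X"
  then obtain y where y: "y \<in> X" "y \<noteq> 0" "proj_rel `` {x} = proj_rel `` {y}"
    by (auto simp: projectivise_def quotient_def)
  then have "(x, y) \<in> proj_rel"
    using \<open>x \<noteq> 0\<close> eq_equiv_class_iff[OF equiv_proj_rel, of x y] by simp
  then consider k where "x = k *s y" | k where "y = k *s x"
    by (auto simp: proj_rel_def)
  then show "x \<in> X"
  proof cases
    case 1
    then show ?thesis using y(1) by (simp add: scale)
  next
    case 2
    then have "k \<noteq> 0" using y(2) by auto
    then obtain l where "l * k = 1" using trop_left_inverse by blast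
    then have "x = l *s y" using 2 by simp
    then show ?thesis using y(1) by (simp add: scale)
  qed
qed (use \<open>x \<noteq> 0\<close> in \<open>auto simp: projectivise_def intro: quotientI\<close>)

lemma projectivise_inject:
  assumes "\<And>k x. x \<in> X \<Longrightarrow> k *s x \<in> X" "0 \<in> X"
    and "\<And>k x. x \<in> Y \<Longrightarrow> k *s x \<in> Y" "0 \<in> Y"
  shows "projectivise X = projectivise Y \<longleftrightarrow> X = Y"
proof
  assume "projectivise X = projectivise Y"
  then have nonzero: "x \<in> X \<longleftrightarrow> x \<in> Y" if "x \<noteq> 0" for x
    using class_in_projectivise_iff[OF assms(1) that] class_in_projectivise_iff[OF assms(3) that]
    by simp
  show "X = Y"
  proof (rule Set.set_eqI)
    show "x \<in> X \<longleftrightarrow> x \<in> Y" for x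
      by (cases "x = 0") (simp_all add: assms(2,4) nonzero)
  qed
qed simp

lemma scale_in_col_space: "x \<in> col_space A \<Longrightarrow> k *s x \<in> col_space A"
proof -
  assume "x \<in> col_space A"
  then obtain v where "x = A *v v" by (auto simp: col_space_eq_range)
  then have "k *s x = A *v (k *s v)"
    by (simp add: vec_eq_iff matrix_vector_mult_def sum_distrib_left mult.left_commute)
  then show ?thesis by (simp add: col_space_eq_range)
qed

lemma zero_in_col_space: "0 \<in> col_space A"
proof -
  have "0 = A *v 0" by (simp add: vec_eq_iff matrix_vector_mult_def)
  then show ?thesis unfolding col_space_eq_range by blast
qed

theorem proj_col_space_eq_iff: "proj_col_space A = proj_col_space B \<longleftrightarrow> col_space A = col_space B"
  unfolding proj_col_space_def
  by (intro projectivise_inject scale_in_col_space zero_in_col_space)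

theorem proj_row_space_eq_iff: "proj_row_space A = proj_row_space B \<longleftrightarrow> row_space A = row_space B"
  unfolding proj_row_space_def row_space_eq_col_space_transpose
  by (intro projectivise_inject scale_in_col_space zero_in_col_space)

theorem corollary3p2:
  fixes A B :: "trop ^ 'n ^ 'n"
  shows "((green_R trop_matrix_monoid A B \<longleftrightarrow> col_space A = col_space B) \<and>
          (col_space A = col_space B \<longleftrightarrow> proj_col_space A = proj_col_space B)) \<and>
         ((green_L trop_matrix_monoid A B \<longleftrightarrow> row_space A = row_space B) \<and>
          (row_space A = row_space B \<longleftrightarrow> proj_row_space A = proj_row_space B))"
  by (simp add: green_R_iff_col_space green_L_iff_row_space
      proj_col_space_eq_iff proj_row_space_eq_iff)

end
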